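(* Let $n,m\ge 3$ be odd integers, let $S$ be a 2-partition of $\mathbb{Z}_n^*$ and $T$ a 2-partition of $\mathbb{Z}_m^*$, and let $W_{ST}$ be any product of $S$ and $T$ (for any admissible choice of $\tilde S$ and $\bar T$). 1. If both $S$ and $T$ are Skolem starters and, in addition, $S$ is strong and $T$ is skew, then $W_{ST}$ is a strong Skolem starter in $\mathbb{Z}_{nm}$. Moreover, if $S$ and $T$ are both skew Skolem starters in their groups, then $W_{ST}$ is a skew Skolem starter in $\mathbb{Z}_{nm}$. 2. If $W_{ST}$ is a strong but not skew Skolem starter, then $S$ is a strong but not skew Skolem starter and $T$ is a skew Skolem starter. If $W_{ST}$ is a skew Skolem starter, then both $S$ and $T$ are skew Skolem starters.
   Context: For odd $k=2\ell+1\ge3$, $\mathbb{Z}_k^*=\mathbb{Z}_k\setminus\{0\}$ with order $1<2<\dots<k-1$. A 2-partition of $\mathbb{Z}_k^*$ is a partition into $\ell$ unordered pairs $\{x_i,y_i\}$; it is a starter in $\mathbb{Z}_k$ if $\{\pm(x_i-y_i)\bmod k\}=\mathbb{Z}_k^*$; strong if the sums $x_i+y_i\bmod k$ are nonzero and pairwise distinct; skew if $\{\pm(x_i+y_i)\bmod k\}=\mathbb{Z}_k^*$; Skolem if every pair $\{x,y\}$ with $x<y$ satisfies $y-x\le \ell$. A (strong/skew) Skolem starter is a starter that is (strong/skew and) Skolem. Product: let $S$ be a 2-partition of $\mathbb{Z}_n^*$, $n=2q+1$, and $T$ a 2-partition of $\mathbb{Z}_m^*$, $m=2p+1$. Let $\tilde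 S$ be any set of ordered pairs obtained by ordering each pair of $S$ in either way. Let $\bar T=\{(r_j,t_j)\}_{j=1}^p$ be obtained by ordering each pair of $T$ so that $\bigcup_j\{\pm r_j\}=\mathbb{Z}_m^*$ (such orderings always exist), and $\bar T'=\{(-r_j,-t_j)\}_{j=1}^p$. A product $W_{ST}$ of $S$ and $T$ is the collection of $2pq+p+q$ unordered pairs $\{nr+x,\ nt+y\}$ (taken mod $nm$, with $x,y$ represented in $\{0,\dots,n-1\}$) of two types: (i) one pair for each $(r,t)\in\bar T\cup\bar T'\cup\{(0,0)\}$ and each $(x,y)\in\tilde S$; (ii) one pair for each $(r,t)\in\bar T$ with $x=y=0$. *)

theory Defs
  imports Main "HOL-Library.Disjoint_Sets"
begin

text \<open>
  Elements of \<open>\<int>\<^sub>k\<close> are represented by the integers \<open>0, \<dots>, k - 1\<close>, so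
  \<open>\<int>\<^sub>k\<^sup>*\<close> with its order \<open>1 < \<dots> < k - 1\<close> is \<open>{1..<k}\<close>.
  Unordered pairs are two-element sets.
\<close>

definition two_partition :: "int \<Rightarrow> int set set \<Rightarrow> bool" where
  "two_partition k P \<longleftrightarrow> partition_on {1..<k} P \<and> (\<forall>p\<in>P. card p = 2)"

text \<open>Both signs of a difference occur because \<open>{x, y} = {y, x}\<close>.\<close>

definition starter :: "int \<Rightarrow> int set set \<Rightarrow> bool" where
  "starter k P \<longleftrightarrow> two_partition k P \<and>
     {(x - y) mod k | x y. {x, y} \<in> P} = {1..<k}"

definition strong :: "int \<Rightarrow> int set set \<Rightarrow> bool" where
  "strong k P \<longleftrightarrow>
     (\<forall>p\<in>P. (\<Sum>x\<in>p. x) mod k \<noteq> 0) \<and> inj_on (\<lambda>p. (\<Sum>x\<in>p. x) mod k) P"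

definition skew :: "int \<Rightarrow> int set set \<Rightarrow> bool" where
  "skew k P \<longleftrightarrow>
     (\<Union>p\<in>P. {(\<Sum>x\<in>p. x) mod k, (- (\<Sum>x\<in>p. x)) mod k}) = {1..<k}"

definition skolem :: "int \<Rightarrow> int set set \<Rightarrow> bool" where
  "skolem k P \<longleftrightarrow> (\<forall>x y. {x, y} \<in> P \<and> x < y \<longrightarrow> y - x \<le> (k - 1) div 2)"

definition skolem_starter :: "int \<Rightarrow> int set set \<Rightarrow> bool" where
  "skolem_starter k P \<longleftrightarrow> starter k P \<and> skolem k P"

definition strong_skolem_starter :: "int \<Rightarrow> int set set \<Rightarrow> bool" where
  "strong_skolem_starter k P \<longleftrightarrow> skolem_starter k P \<and> strong k P"

definition skew_skolem_starter :: "int \<Rightarrow> int set set \<Rightarrow> bool" where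
  "skew_skolem_starter k P \<longleftrightarrow> skolem_starter k P \<and> skew k P"

text \<open>\<open>Q\<close> arises from \<open>P\<close> by ordering each pair of \<open>P\<close> in exactly one of the two ways.\<close>

definition ordering_of :: "(int \<times> int) set \<Rightarrow> int set set \<Rightarrow> bool" where
  "ordering_of Q P \<longleftrightarrow> bij_betw (\<lambda>(x, y). {x, y}) Q P"

definition admissible_ordering :: "int \<Rightarrow> (int \<times> int) set \<Rightarrow> int set set \<Rightarrow> bool" where
  "admissible_ordering m Q T \<longleftrightarrow> ordering_of Q T \<and>
     (\<Union>(r, t)\<in>Q. {r mod m, (- r) mod m}) = {1..<m}"

definition neg_pairs :: "int \<Rightarrow> (int \<times> int) set \<Rightarrow> (int \<times> int) set" where
  "neg_pairs m Q = (\<lambda>(r, t). ((- r) mod m, (- t) mod m)) ` Q"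

definition product_of_orderings ::
    "int \<Rightarrow> int \<Rightarrow> (int \<times> int) set \<Rightarrow> (int \<times> int) set \<Rightarrow> int set set" where
  "product_of_orderings n m S' T' =
     {{(n * r + x) mod (n * m), (n * t + y) mod (n * m)} | r t x y.
        (r, t) \<in> T' \<union> neg_pairs m T' \<union> {(0, 0)} \<and> (x, y) \<in> S'}
     \<union> {{(n * r) mod (n * m), (n * t) mod (n * m)} | r t. (r, t) \<in> T'}"

definition is_product ::
    "int \<Rightarrow> int \<Rightarrow> int set set \<Rightarrow> int set set \<Rightarrow> int set set \<Rightarrow> bool" where
  "is_product n m S T W \<longleftrightarrow>
     (\<exists>S' T'. ordering_of S' S \<and> admissible_ordering m T' T \<and>
        W = product_of_orderings n m S' T')"

end

theory Submission imports Defs begin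

text \<open>
  Order the pairs of every 2-partition and let \<open>U\<close> consist of the ordered pairs of \<open>T\<close>, their
  negatives and \<open>(0, 0)\<close>. For \<open>e = \<plusminus>1\<close>, a product pair has \<open>e\<close>-combination
  \<open>n (r + e t) + (x + e y)\<close>: reduction modulo \<open>n\<close> recovers the combination \<open>x + e y\<close> of \<open>S\<close>, and
  the multiples of \<open>n\<close> recover \<open>r + e t\<close> modulo \<open>m\<close>. The two coordinates of \<open>U\<close> each run once
  through all residues modulo \<open>m\<close>, so \<open>U\<close> has exactly \<open>m\<close> elements; by counting, \<open>r + e t\<close> is
  injective on \<open>U\<close> modulo \<open>m\<close> iff it is surjective, that is, iff \<open>T\<close> is a starter (\<open>e = -1\<close>) or skew
  (\<open>e = 1\<close>). This makes both directions congruence arguments.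
\<close>

section \<open>Congruence notions for ordered pairs\<close>

text \<open>A directed perfect matching of the nonzero residues. Disjointness and size two of blocks
  become injectivity and disjointness of the coordinate projections, which survive the product
  construction entry by entry.\<close>

definition oriented :: "int \<Rightarrow> (int \<times> int) set \<Rightarrow> bool" where
  "oriented k Q \<longleftrightarrow> inj_on fst Q \<and> inj_on snd Q \<and> fst ` Q \<inter> snd ` Q = {}
     \<and> fst ` Q \<union> snd ` Q = {1..<k}"

abbreviation unordered :: "int \<times> int \<Rightarrow> int set" where
  "unordered \<equiv> \<lambda>(x, y). {x, y}"

text \<open>The starter condition is the case \<open>e = -1\<close>, the skew condition the case \<open>e = 1\<close>.\<close>

definition covers :: "int \<Rightarrow> int \<Rightarrow> (int \<times> int) set \<Rightarrow> bool" where
  "covers k e Q \<longleftrightarrow> (\<forall>(x, y)\<in>Q. \<not> k dvd x + e * y) \<and>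
     (\<forall>w. \<not> k dvd w \<longrightarrow> (\<exists>(x, y)\<in>Q. k dvd w - (x + e * y) \<or> k dvd w + (x + e * y)))"

text \<open>Stated with divisibility instead of \<open>mod\<close>, so that sums of product pairs
  can be regrouped as integers before any reduction.\<close>

definition distinct_sums :: "int \<Rightarrow> (int \<times> int) set \<Rightarrow> bool" where
  "distinct_sums k Q \<longleftrightarrow> (\<forall>(x, y)\<in>Q. \<not> k dvd x + y) \<and>
     (\<forall>(x, y)\<in>Q. \<forall>(x', y')\<in>Q. k dvd (x + y) - (x' + y') \<longrightarrow> (x, y) = (x', y'))"

definition short_gaps :: "int \<Rightarrow> (int \<times> int) set \<Rightarrow> bool" where
  "short_gaps k Q \<longleftrightarrow> (\<forall>(x, y)\<in>Q. \<bar>x - y\<bar> \<le> (k - 1) div 2)"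

definition sym_hull :: "int \<Rightarrow> (int \<times> int) set \<Rightarrow> (int \<times> int) set" where
  "sym_hull m Q = Q \<union> neg_pairs m Q \<union> {(0, 0)}"

text \<open>No reduction modulo \<open>n * m\<close> is made: for the hull of an admissible ordering
  all entries already lie below \<open>n * m\<close>.\<close>

definition product_pairs ::
    "int \<Rightarrow> (int \<times> int) set \<Rightarrow> (int \<times> int) set \<Rightarrow> (int \<times> int) set \<Rightarrow> (int \<times> int) set" where
  "product_pairs n S' T' U =
     {(n * r + x, n * t + y) | r t x y. (r, t) \<in> U \<and> (x, y) \<in> S'}
     \<union> {(n * r, n * t) | r t. (r, t) \<in> T'}"

section \<open>Orderings of 2-partitions\<close>

lemma oriented_mem:
  assumes "oriented k Q" "(x, y) \<in> Q"
  shows "x \<in> {1..<k}" "y \<in> {1..<k}" "x \<noteq> y"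
proof -
  have "x \<in> fst ` Q" "y \<in> snd ` Q" using assms(2) by force+
  then show "x \<in> {1..<k}" "y \<in> {1..<k}" "x \<noteq> y"
    using assms(1) unfolding oriented_def by blast+
qed

text \<open>First and second coordinates never coincide, so a shared element sits in the same
  position of both pairs, and injectivity of that projection finishes.\<close>

lemma oriented_eqI:
  assumes "oriented k Q" "(x, y) \<in> Q" "(x', y') \<in> Q" "{x, y} \<inter> {x', y'} \<noteq> {}"
  shows "(x, y) = (x', y')"
proof -
  have "x \<in> fst ` Q" "y \<in> snd ` Q" "x' \<in> fst ` Q" "y' \<in> snd ` Q"
    using assms(2,3) by force+
  then have "x = x' \<or> y = y'"
    using assms(1,4) unfolding oriented_def by blast
  moreover have "inj_on fst Q" "inj_on snd Q" using assms(1) unfolding oriented_def by auto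
  ultimately show ?thesis using inj_onD assms(2,3) by (metis fst_conv snd_conv)
qed

lemma oriented_finite:
  assumes "oriented k Q"
  shows "finite Q"
proof -
  have "finite (fst ` Q)" using assms unfolding oriented_def
    by (metis finite_Un finite_atLeastLessThan_int)
  then show ?thesis using assms finite_imageD unfolding oriented_def by blast
qed

lemma oriented_card:
  assumes "oriented k Q"
  shows "2 * card Q = nat (k - 1)"
proof -
  have "card (fst ` Q \<union> snd ` Q) = card (fst ` Q) + card (snd ` Q)"
    using assms oriented_finite[OF assms] unfolding oriented_def
    by (intro card_Un_disjoint) auto
  then show ?thesis
    using assms unfolding oriented_def by (simp add: card_image)
qed

lemma mem_image_unordered:
  assumes "(x, y) \<in> Q"
  shows "{x, y} \<in> unordered ` Q" "{y, x} \<in> unordered ` Q"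
  using assms by (auto intro: rev_image_eqI)

lemma Union_image_unordered: "\<Union>(unordered ` Q) = fst ` Q \<union> snd ` Q"
  by force

text \<open>Blocks that meet are equal, and bijectivity of the ordering then makes the ordered pairs
  equal. An element in both a first and a second position would thus be paired with itself,
  contradicting block size two.\<close>

lemma oriented_of_ordering:
  assumes "two_partition k P" "ordering_of Q P"
  shows "oriented k Q" "P = unordered ` Q"
proof -
  have part: "partition_on {1..<k} P" and c2: "\<And>p. p \<in> P \<Longrightarrow> card p = 2"
    using assms(1) unfolding two_partition_def by auto
  show P: "P = unordered ` Q"
    using assms(2) unfolding ordering_of_def bij_betw_def by simp
  have inj: "inj_on unordered Q"
    using assms(2) unfolding ordering_of_def bij_betw_def by simp
  have ne: "x \<noteq> y" if "(x, y) \<in> Q" for x y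
    using c2[of "{x, y}"] mem_image_unordered(1)[OF that] unfolding P[symmetric] by auto
  have eq: "(x, y) = (x', y')"
    if h: "(x, y) \<in> Q" "(x', y') \<in> Q" "{x, y} \<inter> {x', y'} \<noteq> {}" for x y x' y'
  proof -
    have "{x, y} \<in> P" "{x', y'} \<in> P"
      unfolding P using h(1,2) by (simp_all only: mem_image_unordered)
    then have "{x, y} = {x', y'}"
      using disjointD[OF partition_onD2[OF part]] h(3) by metis
    then show ?thesis using inj_onD[OF inj, of "(x, y)" "(x', y')"] h(1,2) by simp
  qed
  have "\<Union>P = {1..<k}" using partition_onD1[OF part] by simp
  moreover have "\<Union>P = fst ` Q \<union> snd ` Q" unfolding P by (rule Union_image_unordered)
  moreover have "inj_on fst Q" "inj_on snd Q"
    by (rule inj_onI, clarsimp, drule (1) eq, simp, simp)+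
  moreover have "fst ` Q \<inter> snd ` Q = {}"
  proof -
    have False if "(x, y) \<in> Q" "(x', x) \<in> Q" for x y x'
      using eq[OF that] ne[OF that(1)] by auto
    then show ?thesis by auto
  qed
  ultimately show "oriented k Q" unfolding oriented_def by simp
qed

lemma two_partition_of_oriented:
  assumes "oriented k Q"
  shows "two_partition k (unordered ` Q)"
proof -
  have "disjoint (unordered ` Q)"
    unfolding disjoint_def
  proof clarify
    fix x y x' y'
    assume h: "(x, y) \<in> Q" "(x', y') \<in> Q" "{x, y} \<noteq> {x', y'}"
    then show "{x, y} \<inter> {x', y'} = {}" using oriented_eqI[OF assms h(1,2)] by auto
  qed
  moreover have "card {x, y} = 2" if "(x, y) \<in> Q" for x y
    using oriented_mem(3)[OF assms that] by simp
  moreover have "\<Union>(unordered ` Q) = {1..<k}"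
    using assms unfolding oriented_def Union_image_unordered by simp
  ultimately show ?thesis
    unfolding two_partition_def partition_on_def by auto
qed

section \<open>Starter, skew, strong and Skolem conditions as congruences and gap bounds\<close>

text \<open>\<open>{1..<k}\<close> represents the nonzero classes: the first clause of
  \<open>covers\<close> corresponds to one inclusion, the second to the other.\<close>

lemma covers_iff_residues:
  assumes "k > 0"
  shows "covers k e Q \<longleftrightarrow>
    (\<Union>(x, y)\<in>Q. {(x + e * y) mod k, (- (x + e * y)) mod k}) = {1..<k}" (is "_ \<longleftrightarrow> ?A = _")
proof
  assume c: "covers k e Q"
  have "?A \<subseteq> {1..<k}"
  proof
    fix w assume "w \<in> ?A"
    then obtain x y where xy: "(x, y) \<in> Q" "w = (x + e * y) mod k \<or> w = (- (x + e * y)) mod k"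
      by auto
    then have "\<not> k dvd x + e * y" using c unfolding covers_def by auto
    then have "w \<noteq> 0" using xy(2) by (metis dvd_minus_iff dvd_eq_mod_eq_0)
    then show "w \<in> {1..<k}" using xy(2) assms pos_mod_sign[OF assms] pos_mod_bound[OF assms]
      by (smt (verit) atLeastLessThan_iff)
  qed
  moreover have "{1..<k} \<subseteq> ?A"
  proof
    fix w assume w: "w \<in> {1..<k}"
    then have "\<not> k dvd w" using zdvd_not_zless by auto
    then obtain x y where xy: "(x, y) \<in> Q" "k dvd w - (x + e * y) \<or> k dvd w + (x + e * y)"
      using c unfolding covers_def by blast
    have "w = z mod k" if "k dvd w - z" for z
      using that w by (simp flip: mod_eq_dvd_iff)
    from this[of "x + e * y"] this[of "- (x + e * y)"]
    have "w = (x + e * y) mod k \<or> w = (- (x + e * y)) mod k"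
      using xy(2) unfolding diff_minus_eq_add by argo
    then show "w \<in> ?A" using xy(1) by blast
  qed
  ultimately show "?A = {1..<k}" by blast
next
  assume A: "?A = {1..<k}"
  have "\<not> k dvd x + e * y" if "(x, y) \<in> Q" for x y
  proof -
    have "(x + e * y) mod k \<in> {1..<k}" unfolding A[symmetric] using that by blast
    then show ?thesis by auto
  qed
  moreover have "\<exists>(x, y)\<in>Q. k dvd w - (x + e * y) \<or> k dvd w + (x + e * y)"
    if "\<not> k dvd w" for w
  proof -
    have "w mod k \<in> {1..<k}"
      using that pos_mod_sign[OF assms, of w] pos_mod_bound[OF assms, of w] unfolding dvd_eq_mod_eq_0 atLeastLessThan_iff
      by linarith
    then obtain x y where xy: "(x, y) \<in> Q"
      "w mod k = (x + e * y) mod k \<or> w mod k = (- (x + e * y)) mod k"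
      unfolding A[symmetric] by auto
    then have "k dvd w - (x + e * y) \<or> k dvd w + (x + e * y)"
      using mod_eq_dvd_iff[of w k "x + e * y"] mod_eq_dvd_iff[of w k "- (x + e * y)"]
      unfolding diff_minus_eq_add by argo
    then show ?thesis using xy(1) by blast
  qed
  ultimately show "covers k e Q" unfolding covers_def by blast
qed

text \<open>A block can be read in either order, and the two readings give the differences of both
  signs.\<close>

lemma starter_iff:
  assumes "k > 0" "oriented k Q"
  shows "starter k (unordered ` Q) \<longleftrightarrow> covers k (-1) Q"
proof -
  have "{(x - y) mod k | x y. {x, y} \<in> unordered ` Q} =
    (\<Union>(x, y)\<in>Q. {(x + (-1) * y) mod k, (- (x + (-1) * y)) mod k})" (is "?A = ?B")
  proof
    show "?A \<subseteq> ?B"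
    proof
      fix w assume "w \<in> ?A"
      then obtain x y x' y' where "w = (x - y) mod k" "(x', y') \<in> Q" "{x, y} = {x', y'}"
        by auto
      then show "w \<in> ?B" by (force simp: doubleton_eq_iff)
    qed
    show "?B \<subseteq> ?A"
    proof
      fix w assume "w \<in> ?B"
      then obtain x y where xy: "(x, y) \<in> Q" "w = (x - y) mod k \<or> w = (y - x) mod k"
        by auto
      have "{x, y} \<in> unordered ` Q" "{y, x} \<in> unordered ` Q"
        using xy(1) by (rule mem_image_unordered)+
      then show "w \<in> ?A" using xy(2) by blast
    qed
  qed
  then show ?thesis
    using covers_iff_residues[OF assms(1)] two_partition_of_oriented[OF assms(2)]
    unfolding starter_def by simp
qed

lemma sum_unordered:
  assumes "oriented k Q" "(x, y) \<in> Q"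
  shows "\<Sum>{x, y} = x + y"
  using oriented_mem(3)[OF assms] by simp

lemma skew_iff:
  assumes "k > 0" "oriented k Q"
  shows "skew k (unordered ` Q) \<longleftrightarrow> covers k 1 Q"
proof -
  have "(\<Union>p\<in>unordered ` Q. {\<Sum>p mod k, (- \<Sum>p) mod k}) =
    (\<Union>(x, y)\<in>Q. {(x + 1 * y) mod k, (- (x + 1 * y)) mod k})"
    unfolding image_image
    by (rule SUP_cong[OF refl]) (use sum_unordered[OF assms(2)] in auto)
  then show ?thesis using covers_iff_residues[OF assms(1)] unfolding skew_def by simp
qed

lemma inj_on_unordered:
  assumes "oriented k Q"
  shows "inj_on unordered Q"
proof (rule inj_onI, clarify)
  fix x y x' y' assume h: "(x, y) \<in> Q" "(x', y') \<in> Q" "{x, y} = {x', y'}"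
  then show "x = x' \<and> y = y'" using oriented_eqI[OF assms h(1,2)] by auto
qed

lemma strong_iff:
  assumes "oriented k Q"
  shows "strong k (unordered ` Q) \<longleftrightarrow> distinct_sums k Q"
proof -
  \<comment> \<open>Distinct ordered pairs give distinct blocks, so injectivity on blocks can be
    pulled back to \<open>Q\<close>.\<close>
  have "inj_on (\<lambda>p. \<Sum>p mod k) (unordered ` Q) \<longleftrightarrow> inj_on ((\<lambda>p. \<Sum>p mod k) \<circ> unordered) Q"
    using comp_inj_on_iff[OF inj_on_unordered[OF assms]] .
  also have "\<dots> \<longleftrightarrow> inj_on (\<lambda>(x, y). (x + y) mod k) Q"
    by (rule inj_on_cong) (clarsimp simp del: sum.insert simp: sum_unordered[OF assms])
  also have "\<dots> \<longleftrightarrow> (\<forall>(x, y)\<in>Q. \<forall>(x', y')\<in>Q. k dvd (x + y) - (x' + y') \<longrightarrow> (x, y) = (x', y'))"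
    unfolding inj_on_def by (simp add: split_beta mod_eq_dvd_iff prod_eq_iff)
  finally have "inj_on (\<lambda>p. \<Sum>p mod k) (unordered ` Q) \<longleftrightarrow> \<dots>" .
  moreover have "(\<forall>p\<in>unordered ` Q. \<Sum>p mod k \<noteq> 0) \<longleftrightarrow> (\<forall>(x, y)\<in>Q. \<not> k dvd x + y)"
    by (simp add: ball_simps split_beta dvd_eq_mod_eq_0 sum_unordered[OF assms] del: sum.insert cong: ball_cong)
  ultimately show ?thesis unfolding strong_def distinct_sums_def by simp
qed

lemma skolem_iff:
  assumes "k > 0"
  shows "skolem k (unordered ` Q) \<longleftrightarrow> short_gaps k Q"
proof
  assume s: "skolem k (unordered ` Q)"
  have "\<bar>x - y\<bar> \<le> (k - 1) div 2" if "(x, y) \<in> Q" for x y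
  proof -
    have "{x, y} \<in> unordered ` Q" "{y, x} \<in> unordered ` Q"
      using that by (rule mem_image_unordered)+
    then have "x < y \<Longrightarrow> y - x \<le> (k - 1) div 2" "y < x \<Longrightarrow> x - y \<le> (k - 1) div 2"
      using s unfolding skolem_def by auto
    moreover have "0 \<le> (k - 1) div 2" using assms by simp
    ultimately show ?thesis by linarith
  qed
  then show "short_gaps k Q" unfolding short_gaps_def by blast
next
  assume s: "short_gaps k Q"
  have "y - x \<le> (k - 1) div 2" if h: "{x, y} \<in> unordered ` Q" for x y
  proof -
    obtain x' y' where "(x', y') \<in> Q" "{x, y} = {x', y'}" using h by auto
    then show ?thesis using s unfolding short_gaps_def by (fastforce simp: doubleton_eq_iff)
  qed
  then show "skolem k (unordered ` Q)" unfolding skolem_def by auto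
qed

text \<open>
  The \<open>k - 1\<close> nonzero residues are covered by two images of \<open>Q\<close>, which has only \<open>(k - 1) / 2\<close>
  elements, so each image map must be injective.
\<close>

lemma distinct_sums_of_covers:
  assumes "k > 0" "oriented k Q" "covers k 1 Q"
  shows "distinct_sums k Q"
proof -
  let ?f = "\<lambda>(x, y). (x + y) mod k" and ?g = "\<lambda>(x, y). (- (x + y)) mod k"
  have fin: "finite Q" by (rule oriented_finite[OF assms(2)])
  have "?f ` Q \<union> ?g ` Q = (\<Union>(x, y)\<in>Q. {(x + 1 * y) mod k, (- (x + 1 * y)) mod k})"
    by (simp add: split_beta set_eq_iff image_iff bex_disj_distrib)
  then have "?f ` Q \<union> ?g ` Q = {1..<k}"
    using covers_iff_residues[OF assms(1), of 1 Q] assms(3) by simp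
  then have "nat (k - 1) \<le> card (?f ` Q) + card (?g ` Q)"
    by (metis card_Un_le card_atLeastLessThan_int)
  moreover have "card (?f ` Q) \<le> card Q" "card (?g ` Q) \<le> card Q"
    by (intro card_image_le fin)+
  ultimately have "card (?f ` Q) = card Q" using oriented_card[OF assms(2)] by linarith
  then have "inj_on ?f Q" using fin eq_card_imp_inj_on by blast
  then have "\<forall>(x, y)\<in>Q. \<forall>(x', y')\<in>Q. k dvd (x + y) - (x' + y') \<longrightarrow> (x, y) = (x', y')"
    unfolding inj_on_def by (simp add: split_beta mod_eq_dvd_iff prod_eq_iff)
  then show ?thesis using assms(3) unfolding distinct_sums_def covers_def by simp
qed

lemma coversD:
  assumes "covers k e Q"
  shows "(x, y) \<in> Q \<Longrightarrow> \<not> k dvd x + e * y"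
    and "\<not> k dvd w \<Longrightarrow> \<exists>x y. (x, y) \<in> Q \<and> (k dvd w - (x + e * y) \<or> k dvd w + (x + e * y))"
  using assms unfolding covers_def by blast+

lemma distinct_sumsD:
  assumes "distinct_sums k Q"
  shows "(x, y) \<in> Q \<Longrightarrow> \<not> k dvd x + y"
    and "(x, y) \<in> Q \<Longrightarrow> (x', y') \<in> Q \<Longrightarrow> k dvd (x + y) - (x' + y') \<Longrightarrow> x = x' \<and> y = y'"
  using assms unfolding distinct_sums_def by blast+

lemma short_gapsD: "short_gaps k Q \<Longrightarrow> (x, y) \<in> Q \<Longrightarrow> \<bar>x - y\<bar> \<le> (k - 1) div 2"
  unfolding short_gaps_def by blast

section \<open>The symmetric hull of an admissible ordering\<close>

lemma dvd_linear_comb: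
  fixes m :: int
  assumes "m dvd a" "m dvd b"
  shows "m dvd a + e * b"
  using assms by simp

lemma neg_mod_dvd: "(m :: int) dvd a + (- a) mod m"
  by (metis add.right_inverse dvd_eq_mod_eq_0 mod_0 mod_add_right_eq)

lemma neg_mod_eq:
  fixes m :: int
  assumes "a \<in> {1..<m}"
  shows "(- a) mod m = m - a"
  using assms by (simp add: zmod_zminus1_eq_if)

lemma fst_neg_pairs: "fst ` neg_pairs m Q = (\<lambda>r. (- r) mod m) ` fst ` Q"
  and snd_neg_pairs: "snd ` neg_pairs m Q = (\<lambda>t. (- t) mod m) ` snd ` Q"
  unfolding neg_pairs_def image_image by (auto intro!: image_cong simp: split_beta)

lemma sym_hull_cases:
  assumes "(r, t) \<in> sym_hull m Q"
  obtains "r = 0" "t = 0" | "(r, t) \<in> Q"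
    | a b where "(a, b) \<in> Q" "r = (- a) mod m" "t = (- b) mod m"
  using assms unfolding sym_hull_def neg_pairs_def by auto

lemma sym_hullI:
  shows "(0, 0) \<in> sym_hull m Q"
    and "(r, t) \<in> Q \<Longrightarrow> (r, t) \<in> sym_hull m Q"
    and "(r, t) \<in> Q \<Longrightarrow> ((- r) mod m, (- t) mod m) \<in> sym_hull m Q"
  unfolding sym_hull_def neg_pairs_def by force+

locale admissible =
  fixes m :: int and Q :: "(int \<times> int) set"
  assumes m_pos: "m > 0" and oriented: "oriented m Q"
    and half: "(\<Union>(r, t)\<in>Q. {r mod m, (- r) mod m}) = {1..<m}"
begin

abbreviation "U \<equiv> sym_hull m Q"

lemma finite_hull: "finite U"
  using oriented_finite[OF oriented] unfolding sym_hull_def neg_pairs_def by simp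

text \<open>With \<open>R\<close>, \<open>D\<close> the first and second coordinates of
  \<open>Q\<close>, admissibility puts \<open>D\<close> inside \<open>-R\<close>, hence
  \<open>-D\<close> inside \<open>R\<close>. Counting gives \<open>-D = R\<close> and so
  \<open>-R = D\<close>. Either projection of the hull is therefore \<open>R\<close>,
  \<open>D\<close> and 0 together.\<close>

lemma fst_hull: "fst ` U = {0..<m}" and snd_hull: "snd ` U = {0..<m}"
proof -
  let ?N = "\<lambda>r. (- r) mod m" and ?R = "fst ` Q" and ?D = "snd ` Q"
  have RD: "?R \<inter> ?D = {}" "?R \<union> ?D = {1..<m}" and inj: "inj_on fst Q" "inj_on snd Q"
    using oriented unfolding oriented_def by auto
  have fin: "finite Q" by (rule oriented_finite[OF oriented])
  have R: "?R \<union> ?N ` ?R = {1..<m}"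
  proof -
    have "(\<Union>(r, t)\<in>Q. {r mod m, ?N r}) = (\<Union>r\<in>?R. {r mod m, ?N r})" by (simp add: split_beta)
    also have "\<dots> = (\<Union>r\<in>?R. {r, ?N r})"
    proof (rule SUP_cong[OF refl])
      fix r assume "r \<in> ?R"
      then have "r \<in> {1..<m}" using RD(2) by blast
      then show "{r mod m, ?N r} = {r, ?N r}" by simp
    qed
    also have "\<dots> = ?R \<union> ?N ` ?R" by blast
    finally show ?thesis using half by simp
  qed
  have NN: "?N (?N a) = a" if "a \<in> {1..<m}" for a
    using that by (simp add: mod_minus_eq)
  have DR: "?D \<subseteq> ?N ` ?R" using R RD by blast
  have sub: "?N ` ?D \<subseteq> ?R"
  proof
    fix a assume "a \<in> ?N ` ?D"
    then obtain d where d: "d \<in> ?D" "a = ?N d" by blast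
    then obtain r where r: "r \<in> ?R" "d = ?N r" using DR by blast
    have "r \<in> {1..<m}" using r(1) RD(2) by blast
    from NN[OF this] have "a = r" unfolding d(2) r(2) .
    then show "a \<in> ?R" using r(1) by simp
  qed
  have "inj_on ?N {1..<m}" by (rule inj_on_inverseI[of _ ?N]) (rule NN)
  moreover have "?D \<subseteq> {1..<m}" using RD(2) by blast
  ultimately have "card (?N ` ?D) = card ?D" using card_image inj_on_subset by blast
  then have "card (?N ` ?D) = card ?R" using inj by (simp add: card_image)
  \<comment> \<open>Both projections of \<open>Q\<close> are injective, so the two sets have
    \<open>card Q\<close> elements and the inclusion is an equality.\<close>
  then have NDR: "?N ` ?D = ?R" using sub fin by (intro card_subset_eq) auto
  have NRD: "?N ` ?R = ?D"
  proof -
    have "?N ` ?N ` ?D = id ` ?D"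
      unfolding image_image[of ?N ?N ?D]
    proof (rule image_cong[OF refl])
      fix d assume "d \<in> ?D"
      then have "d \<in> {1..<m}" using RD(2) by blast
      from NN[OF this] show "?N (?N d) = id d" by simp
    qed
    then show ?thesis unfolding NDR by simp
  qed
  have zero: "{1..<m} \<union> {0} = {0..<m}" using m_pos by auto
  show "fst ` U = {0..<m}"
    unfolding sym_hull_def image_Un fst_neg_pairs NRD RD(2) using zero by simp
  show "snd ` U = {0..<m}"
    unfolding sym_hull_def image_Un snd_neg_pairs NDR using RD(2) zero by (simp add: Un_commute)
qed

text \<open>The union bound gives at most \<open>2 * card Q + 1 = m\<close>, and the first
  projection already takes \<open>m\<close> values.\<close>

lemma card_hull: "card U = nat m"
proof (rule antisym)
  have "card U \<le> card Q + card (neg_pairs m Q) + card {(0::int, 0::int)}"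
    unfolding sym_hull_def by (meson add_mono card_Un_le le_refl order_trans)
  also have "card (neg_pairs m Q) \<le> card Q"
    unfolding neg_pairs_def by (rule card_image_le[OF oriented_finite[OF oriented]])
  finally show "card U \<le> nat m" using oriented_card[OF oriented] m_pos by simp
  have "card (fst ` U) \<le> card U" by (rule card_image_le[OF finite_hull])
  then show "nat m \<le> card U" unfolding fst_hull by simp
qed

lemma inj_fst_hull: "inj_on fst U" and inj_snd_hull: "inj_on snd U"
  using finite_hull card_hull fst_hull snd_hull by (auto intro!: eq_card_imp_inj_on)

lemma hull_mem:
  assumes "(r, t) \<in> U"
  shows "r \<in> {0..<m}" "t \<in> {0..<m}"
  using imageI[OF assms, of fst] imageI[OF assms, of snd] fst_hull snd_hull by auto

text \<open>Surjectivity onto the residues modulo \<open>m\<close>, which supplies an index with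
  prescribed quotient; \<open>incongruent\<close> is the matching injectivity, which separates
  product pairs.\<close>

definition complete :: "int \<Rightarrow> bool" where
  "complete e \<longleftrightarrow> (\<forall>v. \<exists>(r, t)\<in>U. m dvd v - (r + e * t))"

definition incongruent :: "int \<Rightarrow> bool" where
  "incongruent e \<longleftrightarrow>
     (\<forall>(r, t)\<in>U. \<forall>(r', t')\<in>U. m dvd (r + e * t) - (r' + e * t') \<longrightarrow> r = r' \<and> t = t')"

lemma completeD: "complete e \<Longrightarrow> \<exists>r t. (r, t) \<in> U \<and> m dvd v - (r + e * t)"
  unfolding complete_def by blast

lemma incongruentD:
  "incongruent e \<Longrightarrow> (r, t) \<in> U \<Longrightarrow> (r', t') \<in> U \<Longrightarrow> m dvd (r + e * t) - (r' + e * t')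
    \<Longrightarrow> r = r' \<and> t = t'"
  unfolding incongruent_def by blast

text \<open>A map from the \<open>m\<close> elements of the hull to the \<open>m\<close> residues is
  surjective iff it is injective.\<close>

lemma complete_iff_incongruent: "complete e \<longleftrightarrow> incongruent e"
proof -
  let ?f = "\<lambda>(r, t). (r + e * t) mod m"
  have sub: "?f ` U \<subseteq> {0..<m}" using m_pos by auto
  have "complete e \<longleftrightarrow> (\<forall>v. v mod m \<in> ?f ` U)"
    unfolding complete_def by (simp add: split_beta image_iff mod_eq_dvd_iff)
  also have "\<dots> \<longleftrightarrow> {0..<m} \<subseteq> ?f ` U"
  proof
    assume "\<forall>v. v mod m \<in> ?f ` U"
    then have "v \<in> ?f ` U" if "v \<in> {0..<m}" for v
      using that by (metis atLeastLessThan_iff mod_pos_pos_trivial)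
    then show "{0..<m} \<subseteq> ?f ` U" by blast
  next
    assume "{0..<m} \<subseteq> ?f ` U"
    moreover have "v mod m \<in> {0..<m}" for v using m_pos by simp
    ultimately show "\<forall>v. v mod m \<in> ?f ` U" by blast
  qed
  also have "\<dots> \<longleftrightarrow> card (?f ` U) = card U"
  proof
    assume "{0..<m} \<subseteq> ?f ` U"
    then have "?f ` U = {0..<m}" using sub by blast
    then show "card (?f ` U) = card U" using card_hull by simp
  next
    assume "card (?f ` U) = card U"
    then have "?f ` U = {0..<m}" using sub card_hull by (intro card_subset_eq) auto
    then show "{0..<m} \<subseteq> ?f ` U" by simp
  qed
  also have "\<dots> \<longleftrightarrow> inj_on ?f U"
    using finite_hull by (auto intro: eq_card_imp_inj_on card_image)
  also have "\<dots> \<longleftrightarrow> incongruent e"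
    unfolding inj_on_def incongruent_def by (simp add: split_beta mod_eq_dvd_iff prod_eq_iff)
  finally show ?thesis .
qed

text \<open>The pair \<open>(0, 0)\<close> accounts for the zero class and the negated pairs for the
  second sign in \<open>covers\<close>. Conversely, a zero combination on \<open>Q\<close> would
  collide with that of \<open>(0, 0)\<close>, so the counting equivalence is needed in this
  direction.\<close>

lemma complete_iff_covers: "complete e \<longleftrightarrow> covers m e Q"
proof
  assume c: "covers m e Q"
  have "\<exists>(r, t)\<in>U. m dvd v - (r + e * t)" for v
  proof (cases "m dvd v")
    case True
    then show ?thesis using sym_hullI(1) by force
  next
    case False
    then obtain r t where rt: "(r, t) \<in> Q" "m dvd v - (r + e * t) \<or> m dvd v + (r + e * t)"
      using coversD(2)[OF c] by blast
    show ?thesis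
    proof (cases "m dvd v - (r + e * t)")
      case True
      then show ?thesis using sym_hullI(2)[OF rt(1)] by blast
    next
      case False
      \<comment> \<open>A residue plus its reduced negative is a multiple of \<open>m\<close>, so
        replacing the pair by its negative flips the sign of the combination.\<close>
      then have "m dvd (v + (r + e * t)) - ((r + (- r) mod m) + e * (t + (- t) mod m))"
        using rt(2) dvd_linear_comb[OF neg_mod_dvd neg_mod_dvd] by (intro dvd_diff) auto
      then have "m dvd v - ((- r) mod m + e * ((- t) mod m))"
        by (simp add: algebra_simps)
      then show ?thesis using sym_hullI(3)[OF rt(1)] by blast
    qed
  qed
  then show "complete e" unfolding complete_def by blast
next
  assume c: "complete e"
  then have i: "incongruent e" by (simp add: complete_iff_incongruent)
  have "\<not> m dvd r + e * t" if "(r, t) \<in> Q" for r t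
    using incongruentD[OF i sym_hullI(2)[OF that] sym_hullI(1)] oriented_mem(1)[OF oriented that]
    by auto
  moreover have "\<exists>r t. (r, t) \<in> Q \<and> (m dvd v - (r + e * t) \<or> m dvd v + (r + e * t))"
    if v: "\<not> m dvd v" for v
  proof -
    obtain r t where "(r, t) \<in> U" and dvd: "m dvd v - (r + e * t)" using completeD[OF c] by blast
    from this(1) show ?thesis
    proof (cases rule: sym_hull_cases)
      case 1
      then show ?thesis using dvd v by simp
    next
      case 2
      then show ?thesis using dvd by blast
    next
      case (3 a b)
      \<comment> \<open>The same cancellation, now returning from a negated pair to the pair of
        \<open>Q\<close> behind it.\<close>
      have "m dvd (v - (r + e * t)) + ((a + r) + e * (b + t))"
        using dvd unfolding 3(2,3) by (intro dvd_add[OF _ dvd_linear_comb] neg_mod_dvd) auto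
      then have "m dvd v + (a + e * b)" by (simp add: algebra_simps)
      then show ?thesis using 3(1) by blast
    qed
  qed
  ultimately show "covers m e Q" unfolding covers_def by blast
qed

text \<open>The reduced negative of \<open>(a, b)\<close> is \<open>(m - a, m - b)\<close>, with the
  same absolute gap.\<close>

lemma short_gaps_hull:
  assumes "short_gaps m Q" "(r, t) \<in> U"
  shows "\<bar>r - t\<bar> \<le> (m - 1) div 2"
  using assms(2)
proof (cases rule: sym_hull_cases)
  case 1
  then show ?thesis using m_pos by simp
next
  case 2
  then show ?thesis using short_gapsD[OF assms(1)] by blast
next
  case (3 a b)
  then show ?thesis
    using short_gapsD[OF assms(1) 3(1)] oriented_mem[OF oriented 3(1)] by (simp add: neg_mod_eq)
qed

end

section \<open>Pairs and entries of the product\<close>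

lemma product_pairs_cases:
  assumes "(u, v) \<in> product_pairs n S' T' U"
  obtains (mixed) r t x y where "(r, t) \<in> U" "(x, y) \<in> S'" "u = n * r + x" "v = n * t + y"
    | (pure) r t where "(r, t) \<in> T'" "u = n * r" "v = n * t"
  using assms unfolding product_pairs_def by blast

lemma product_pairsI:
  shows "(r, t) \<in> U \<Longrightarrow> (x, y) \<in> S' \<Longrightarrow> (n * r + x, n * t + y) \<in> product_pairs n S' T' U"
    and "(r, t) \<in> T' \<Longrightarrow> (n * r, n * t) \<in> product_pairs n S' T' U"
  unfolding product_pairs_def by blast+

text \<open>Uniqueness of quotient and remainder; it recovers from a product entry the entries of
  the factors.\<close>

lemma mult_add_eq_cancel:
  fixes n :: int
  assumes "n * r + x = n * r' + x'" "0 \<le> x" "x < n" "0 \<le> x'" "x' < n"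
  shows "r = r' \<and> x = x'"
proof -
  have "(n * r + x) div n = (n * r' + x') div n" "(n * r + x) mod n = (n * r' + x') mod n"
    using assms(1) by simp_all
  then show ?thesis using assms(2-5) by simp
qed

lemma mult_add_mem:
  fixes n m r x :: int
  assumes "0 \<le> r" "r < m" "0 \<le> x" "x < n"
  shows "0 \<le> n * r + x" "n * r + x < n * m"
proof -
  show "0 \<le> n * r + x" using assms by simp
  have "n * (r + 1) \<le> n * m" using assms by (intro mult_left_mono) auto
  then show "n * r + x < n * m" using assms(4) by (simp add: algebra_simps)
qed

lemma image_Collect2: "f ` {g a b | a b. P a b} = {f (g a b) | a b. P a b}"
  and image_Collect4: "f ` {h a b c d | a b c d. R a b c d} = {f (h a b c d) | a b c d. R a b c d}"
  by blast+

locale product_setup = admissible m T' for m T' +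
  fixes n :: int and S' :: "(int \<times> int) set"
  assumes n_pos: "n > 0" and orientedS: "oriented n S'"
begin

abbreviation "W' \<equiv> product_pairs n S' T' U"

lemma dvd_scale: "n * m dvd n * a \<longleftrightarrow> m dvd a"
  using n_pos by simp

lemma regroup: "(n * r + x) + e * (n * t + y) = n * (r + e * t) + (x + e * y)"
  by (simp add: algebra_simps)

text \<open>Passage from modulus \<open>n * m\<close> to modulus \<open>n\<close>, where the
  contribution of \<open>T\<close> vanishes.\<close>

lemma dvd_residual:
  assumes "n * m dvd z" "z = n * a + b"
  shows "n dvd b"
  using assms by (metis dvd_add_right_iff dvd_mult_left dvd_triv_left)

text \<open>Quotient and remainder by \<open>n\<close> determine an entry. Mixed entries have
  nonzero remainder and pure ones remainder 0, so the types do not meet; within a type, the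
  projections of the hull, of \<open>S'\<close> and of \<open>T'\<close> decide.\<close>

lemma oriented_product: "oriented (n * m) W'"
proof -
  have S: "0 \<le> x" "x < n" "0 \<le> y" "y < n" "x \<noteq> 0" "y \<noteq> 0" if "(x, y) \<in> S'" for x y
    using oriented_mem[OF orientedS that] by auto
  have Ssets: "fst ` S' \<inter> snd ` S' = {}" "fst ` S' \<union> snd ` S' = {1..<n}"
    "inj_on fst S'" "inj_on snd S'"
    using orientedS unfolding oriented_def by auto
  have Tsets: "fst ` T' \<inter> snd ` T' = {}" "fst ` T' \<union> snd ` T' = {1..<m}"
    "inj_on fst T'" "inj_on snd T'"
    using oriented unfolding oriented_def by auto
  have sep: False if "n * r + x = n * r'" "0 \<le> x" "x < n" "x \<noteq> 0" for r x r'
    using mult_add_eq_cancel[of n r x r' 0] that by simp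
  have injD: "q = q'" if "inj_on f A" "q \<in> A" "q' \<in> A" "f q = f q'"
    for f :: "int \<times> int \<Rightarrow> int" and A q q'
    using that by (meson inj_onD)
  have "inj_on fst W'"
  proof (rule inj_onI, clarsimp)
    fix u v v' assume "(u, v) \<in> W'" and h: "(u, v') \<in> W'"
    from this(1) show "v = v'"
    proof (cases rule: product_pairs_cases)
      case (mixed r t x y)
      note 1 = this
      from h show ?thesis
      proof (cases rule: product_pairs_cases)
        case (mixed r' t' x' y')
        then have "r = r' \<and> x = x'"
          using 1 S[OF 1(2)] S[OF mixed(2)] by (intro mult_add_eq_cancel[of n]) auto
        then have "(r, t) = (r', t')" "(x, y) = (x', y')"
          using injD[OF inj_fst_hull 1(1) mixed(1)] injD[OF Ssets(3) 1(2) mixed(2)] by auto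
        then show ?thesis using 1 mixed by simp
      next
        case (pure r' t')
        then show ?thesis using sep[of r x r'] 1 S[OF 1(2)] by auto
      qed
    next
      case (pure r t)
      note 1 = this
      from h show ?thesis
      proof (cases rule: product_pairs_cases)
        case (mixed r' t' x' y')
        then show ?thesis using sep[of r' x' r] 1 S[OF mixed(2)] by auto
      next
        case (pure r' t')
        then show ?thesis using 1 injD[OF Tsets(3) 1(1) pure(1)] n_pos by auto
      qed
    qed
  qed
  moreover have "inj_on snd W'"
  proof (rule inj_onI, clarsimp)
    fix u v u' assume "(u, v) \<in> W'" and h: "(u', v) \<in> W'"
    from this(1) show "u = u'"
    proof (cases rule: product_pairs_cases)
      case (mixed r t x y)
      note 1 = this
      from h show ?thesis
      proof (cases rule: product_pairs_cases)
        case (mixed r' t' x' y')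
        then have "t = t' \<and> y = y'"
          using 1 S[OF 1(2)] S[OF mixed(2)] by (intro mult_add_eq_cancel[of n]) auto
        then have "(r, t) = (r', t')" "(x, y) = (x', y')"
          using injD[OF inj_snd_hull 1(1) mixed(1)] injD[OF Ssets(4) 1(2) mixed(2)] by auto
        then show ?thesis using 1 mixed by simp
      next
        case (pure r' t')
        then show ?thesis using sep[of t y t'] 1 S[OF 1(2)] by auto
      qed
    next
      case (pure r t)
      note 1 = this
      from h show ?thesis
      proof (cases rule: product_pairs_cases)
        case (mixed r' t' x' y')
        then show ?thesis using sep[of t' y' t] 1 S[OF mixed(2)] by auto
      next
        case (pure r' t')
        then show ?thesis using 1 injD[OF Tsets(4) 1(1) pure(1)] n_pos by auto
      qed
    qed
  qed
  moreover have "fst ` W' \<inter> snd ` W' = {}"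
  proof -
    have False if "(u, v) \<in> W'" and h: "(v', u) \<in> W'" for u v v'
      using that(1)
    proof (cases rule: product_pairs_cases)
      case (mixed r t x y)
      note 1 = this
      from h show ?thesis
      proof (cases rule: product_pairs_cases)
        case (mixed r' t' x' y')
        then have "r = t' \<and> x = y'"
          using 1 S[OF 1(2)] S[OF mixed(2)] by (intro mult_add_eq_cancel[of n]) auto
        then show ?thesis
          using Ssets(1) imageI[OF 1(2), of fst] imageI[OF mixed(2), of snd] by auto
      next
        case (pure r' t')
        then show ?thesis using sep[of r x t'] 1 S[OF 1(2)] by auto
      qed
    next
      case (pure r t)
      note 1 = this
      from h show ?thesis
      proof (cases rule: product_pairs_cases)
        case (mixed r' t' x' y')
        then show ?thesis using sep[of t' y' r] 1 S[OF mixed(2)] by auto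
      next
        case (pure r' t')
        then have "r = t'" using 1 n_pos by simp
        then show ?thesis
          using Tsets(1) imageI[OF 1(1), of fst] imageI[OF pure(1), of snd] by auto
      qed
    qed
    then show ?thesis by auto
  qed
  moreover have "fst ` W' \<union> snd ` W' = {1..<n * m}"
  proof
    have "u \<in> {1..<n * m} \<and> v \<in> {1..<n * m}" if "(u, v) \<in> W'" for u v
      using that
    proof (cases rule: product_pairs_cases)
      case (mixed r t x y)
      have "r \<in> {0..<m}" "t \<in> {0..<m}" using hull_mem[OF mixed(1)] by auto
      moreover have "0 \<le> n * r" "0 \<le> n * t" using calculation n_pos by auto
      ultimately show ?thesis
        using mixed(3,4) S[OF mixed(2)] mult_add_mem[of r m x n] mult_add_mem[of t m y n]
        unfolding atLeastLessThan_iff by linarith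
    next
      case (pure r t)
      have "0 < r" "r < m" "0 < t" "t < m" using oriented_mem[OF oriented pure(1)] by auto
      then have "0 < n * r" "0 < n * t" "n * r < n * m" "n * t < n * m"
        using n_pos by simp_all
      then show ?thesis using pure(2,3) by auto
    qed
    then show "fst ` W' \<union> snd ` W' \<subseteq> {1..<n * m}" by auto
    show "{1..<n * m} \<subseteq> fst ` W' \<union> snd ` W'"
    proof
      fix w assume w: "w \<in> {1..<n * m}"
      define a where "a = w div n"
      define b where "b = w mod n"
      have wab: "w = n * a + b" unfolding a_def b_def by simp
      have b: "0 \<le> b" "b < n" unfolding b_def using n_pos by auto
      have a: "a \<in> {0..<m}"
      proof -
        have "0 \<le> a" unfolding a_def using w n_pos by (simp add: pos_imp_zdiv_nonneg_iff)
        moreover have "n * a < n * m" using wab b w unfolding atLeastLessThan_iff by linarith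
        ultimately show ?thesis using n_pos by simp
      qed
      show "w \<in> fst ` W' \<union> snd ` W'"
      proof (cases "b = 0")
        case True
        \<comment> \<open>Remainder 0 with \<open>w\<close> positive forces a nonzero
          quotient.\<close>
        then have "a \<in> fst ` T' \<union> snd ` T'" using w wab a unfolding Tsets(2) by (cases "a = 0") auto
        then obtain r t where "(r, t) \<in> T'" "a = r \<or> a = t" by auto
        then show ?thesis using product_pairsI(2)[of r t T' n S' U] wab True by force
      next
        case False
        then have "b \<in> fst ` S' \<union> snd ` S'" using b unfolding Ssets(2) by auto
        then consider y where "(b, y) \<in> S'" | x where "(x, b) \<in> S'" by auto
        then show ?thesis
        proof cases
          case 1
          \<comment> \<open>Any quotient occurs as a first coordinate of the hull, so the position
            of \<open>b\<close> in its pair of \<open>S'\<close> can be matched.\<close>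
          obtain t where "(a, t) \<in> U" using a fst_hull by (metis imageE prod.collapse)
          then show ?thesis using product_pairsI(1)[OF _ 1, of a t U n T'] wab by force
        next
          case 2
          obtain r where "(r, a) \<in> U" using a snd_hull by (metis imageE prod.collapse)
          then show ?thesis using product_pairsI(1)[OF _ 2, of r a U n T'] wab by force
        qed
      qed
    qed
  qed
  ultimately show ?thesis unfolding oriented_def by blast
qed

section \<open>Transfer of the starter, skew and strong conditions\<close>

text \<open>Multiples of \<open>n\<close> are reached by pure pairs, through \<open>T'\<close>
  applied to the quotient. For other targets \<open>S'\<close> fixes the class modulo
  \<open>n\<close> and completeness of the hull adjusts the quotient.\<close>

lemma covers_product:
  assumes cS: "covers n e S'" and cT: "covers m e T'"
  shows "covers (n * m) e W'"
proof -
  have comp: "complete e" using cT by (simp add: complete_iff_covers)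
  have "\<not> n * m dvd u + e * v" if "(u, v) \<in> W'" for u v
    using that
  proof (cases rule: product_pairs_cases)
    case (mixed r t x y)
    then show ?thesis using dvd_residual[of "u + e * v"] regroup coversD(1)[OF cS] by blast
  next
    case (pure r t)
    then have "u + e * v = n * (r + e * t)" by (simp add: algebra_simps)
    then show ?thesis using n_pos coversD(1)[OF cT pure(1)] by simp
  qed
  moreover have "\<exists>u v. (u, v) \<in> W' \<and> (n * m dvd w - (u + e * v) \<or> n * m dvd w + (u + e * v))"
    if w: "\<not> n * m dvd w" for w
  proof (cases "n dvd w")
    case True
    then obtain a where a: "w = n * a" by auto
    then have "\<not> m dvd a" using w n_pos by simp
    then obtain r t where rt: "(r, t) \<in> T'" "m dvd a - (r + e * t) \<or> m dvd a + (r + e * t)"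
      using coversD(2)[OF cT] by blast
    have "w - (n * r + e * (n * t)) = n * (a - (r + e * t))"
      "w + (n * r + e * (n * t)) = n * (a + (r + e * t))"
      unfolding a by (simp_all add: algebra_simps)
    then have "n * m dvd w - (n * r + e * (n * t)) \<or> n * m dvd w + (n * r + e * (n * t))"
      using rt(2) n_pos by simp
    then show ?thesis using product_pairsI(2)[OF rt(1)] by blast
  next
    case False
    then obtain x y where xy: "(x, y) \<in> S'" "n dvd w - (x + e * y) \<or> n dvd w + (x + e * y)"
      using coversD(2)[OF cS] by blast
    from xy(2) show ?thesis
    proof
      assume "n dvd w - (x + e * y)"
      then obtain a where a: "w - (x + e * y) = n * a" by auto
      obtain r t where rt: "(r, t) \<in> U" "m dvd a - (r + e * t)" using completeD[OF comp] by blast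
      have "w - ((n * r + x) + e * (n * t + y)) = n * (a - (r + e * t))"
        using a by (simp add: algebra_simps)
      then have "n * m dvd w - ((n * r + x) + e * (n * t + y))"
        using rt(2) n_pos by simp
      then show ?thesis using product_pairsI(1)[OF rt(1) xy(1)] by blast
    next
      assume "n dvd w + (x + e * y)"
      then obtain a where a: "w + (x + e * y) = n * a" by auto
      \<comment> \<open>For this sign the hull combination must cancel \<open>a\<close>, hence the
        target \<open>- a\<close>.\<close>
      obtain r t where rt: "(r, t) \<in> U" "m dvd - a - (r + e * t)" using completeD[OF comp] by blast
      have "w + ((n * r + x) + e * (n * t + y)) = n * - (- a - (r + e * t))"
        using a by (simp add: algebra_simps)
      then have "n * m dvd w + ((n * r + x) + e * (n * t + y))"
        using rt(2) by (simp only: dvd_scale dvd_minus_iff)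
      then show ?thesis using product_pairsI(1)[OF rt(1) xy(1)] by blast
    qed
  qed
  ultimately show ?thesis unfolding covers_def by blast
qed

text \<open>Modulo \<open>n\<close>, pure pairs give 0 and, by \<open>nz\<close>, mixed pairs do
  not. So non-multiples of \<open>n\<close> are reached only by mixed pairs and multiples only by
  pure ones. The premise \<open>nz\<close> has a different source for each sign: orientation for
  \<open>e = -1\<close>, strongness for \<open>e = 1\<close>.\<close>

lemma covers_factors:
  assumes cW: "covers (n * m) e W'" and nz: "\<And>x y. (x, y) \<in> S' \<Longrightarrow> \<not> n dvd x + e * y"
  shows "covers n e S'" "covers m e T'"
proof -
  have "\<exists>x y. (x, y) \<in> S' \<and> (n dvd w - (x + e * y) \<or> n dvd w + (x + e * y))"
    if w: "\<not> n dvd w" for w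
  proof -
    have "\<not> n * m dvd w" using w dvd_mult_left by blast
    then obtain u v where "(u, v) \<in> W'" and
      uv: "n * m dvd w - (u + e * v) \<or> n * m dvd w + (u + e * v)"
      using coversD(2)[OF cW] by blast
    from this(1) show ?thesis
    proof (cases rule: product_pairs_cases)
      case (mixed r t x y)
      have "w - (u + e * v) = n * - (r + e * t) + (w - (x + e * y))"
        "w + (u + e * v) = n * (r + e * t) + (w + (x + e * y))"
        unfolding mixed(3,4) by (simp_all add: algebra_simps)
      then have "n dvd w - (x + e * y) \<or> n dvd w + (x + e * y)"
        using uv dvd_residual by blast
      then show ?thesis using mixed(2) by blast
    next
      case (pure r t)
      have "w - (u + e * v) = n * - (r + e * t) + w" "w + (u + e * v) = n * (r + e * t) + w"
        unfolding pure(2,3) by (simp_all add: algebra_simps)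
      then show ?thesis using uv dvd_residual w by blast
    qed
  qed
  then show "covers n e S'" unfolding covers_def using nz by blast
  have "\<not> m dvd r + e * t" if "(r, t) \<in> T'" for r t
  proof -
    have "n * r + e * (n * t) = n * (r + e * t)" by (simp add: algebra_simps)
    then show ?thesis
      using coversD(1)[OF cW product_pairsI(2)[OF that]] n_pos by simp
  qed
  moreover have "\<exists>r t. (r, t) \<in> T' \<and> (m dvd a - (r + e * t) \<or> m dvd a + (r + e * t))"
    if a: "\<not> m dvd a" for a
  proof -
    have "\<not> n * m dvd n * a" using a n_pos by simp
    then obtain u v where "(u, v) \<in> W'" and
      uv: "n * m dvd n * a - (u + e * v) \<or> n * m dvd n * a + (u + e * v)"
      using coversD(2)[OF cW] by blast
    from this(1) show ?thesis
    proof (cases rule: product_pairs_cases)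
      case (mixed r t x y)
      have "n * a - (u + e * v) = n * (a - (r + e * t)) + - (x + e * y)"
        "n * a + (u + e * v) = n * (a + (r + e * t)) + (x + e * y)"
        unfolding mixed(3,4) by (simp_all add: algebra_simps)
      then have "n dvd - (x + e * y) \<or> n dvd x + e * y"
        using uv dvd_residual by blast
      then show ?thesis using nz[OF mixed(2)] unfolding dvd_minus_iff by blast
    next
      case (pure r t)
      have "n * a - (u + e * v) = n * (a - (r + e * t))" "n * a + (u + e * v) = n * (a + (r + e * t))"
        unfolding pure(2,3) by (simp_all add: algebra_simps)
      then have "m dvd a - (r + e * t) \<or> m dvd a + (r + e * t)"
        using uv n_pos by simp
      then show ?thesis using pure(1) by blast
    qed
  qed
  ultimately show "covers m e T'" unfolding covers_def by blast
qed

text \<open>Reduction modulo \<open>n\<close> identifies the type and the pair of \<open>S'\<close>;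
  after cancelling it, incongruence on the hull identifies the pair \<open>(r, t)\<close>.\<close>

lemma distinct_sums_product:
  assumes dS: "distinct_sums n S'" and cT: "covers m 1 T'"
  shows "distinct_sums (n * m) W'"
proof -
  have inc: "incongruent 1" using cT by (simp add: complete_iff_covers flip: complete_iff_incongruent)
  have cancel: "r = r' \<and> t = t'"
    if "(r, t) \<in> U" "(r', t') \<in> U" "n * m dvd n * ((r + t) - (r' + t'))" for r t r' t'
    using incongruentD[OF inc that(1,2)] that(3) n_pos by simp
  have "\<not> n * m dvd u + v" if "(u, v) \<in> W'" for u v
    using that
  proof (cases rule: product_pairs_cases)
    case (mixed r t x y)
    then have "u + v = n * (r + t) + (x + y)" by (simp add: algebra_simps)
    then show ?thesis using dvd_residual distinct_sumsD(1)[OF dS mixed(2)] by blast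
  next
    case (pure r t)
    then have "u + v = n * (r + t)" by (simp add: algebra_simps)
    then show ?thesis using n_pos coversD(1)[OF cT pure(1)] by simp
  qed
  moreover have "u = u' \<and> v = v'"
    if "(u, v) \<in> W'" and h: "(u', v') \<in> W'" and d: "n * m dvd (u + v) - (u' + v')" for u v u' v'
    using that(1)
  proof (cases rule: product_pairs_cases)
    case (mixed r t x y)
    note 1 = this
    from h show ?thesis
    proof (cases rule: product_pairs_cases)
      case (mixed r' t' x' y')
      have eq: "(u + v) - (u' + v') = n * ((r + t) - (r' + t')) + ((x + y) - (x' + y'))"
        unfolding 1 mixed by (simp add: algebra_simps)
      have xy: "x = x' \<and> y = y'"
        using distinct_sumsD(2)[OF dS 1(2) mixed(2)] dvd_residual[OF d eq] by blast
      then have "r = r' \<and> t = t'" using cancel[OF 1(1) mixed(1)] d eq by simp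
      then show ?thesis using xy 1 mixed by simp
    next
      case (pure r' t')
      have "(u + v) - (u' + v') = n * ((r + t) - (r' + t')) + (x + y)"
        unfolding 1 pure by (simp add: algebra_simps)
      then show ?thesis using dvd_residual[OF d] distinct_sumsD(1)[OF dS 1(2)] by blast
    qed
  next
    case (pure r t)
    note 1 = this
    from h show ?thesis
    proof (cases rule: product_pairs_cases)
      case (mixed r' t' x' y')
      have "(u + v) - (u' + v') = n * ((r + t) - (r' + t')) + - (x' + y')"
        unfolding 1 mixed by (simp add: algebra_simps)
      then have "n dvd - (x' + y')" using dvd_residual[OF d] by blast
      then show ?thesis using distinct_sumsD(1)[OF dS mixed(2)] by (simp only: dvd_minus_iff)
    next
      case (pure r' t')
      have "(u + v) - (u' + v') = n * ((r + t) - (r' + t'))"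
        unfolding 1 pure by (simp add: algebra_simps)
      \<comment> \<open>Pure indices also belong to the hull, so its incongruence applies to
        them.\<close>
      then show ?thesis
        using cancel[OF sym_hullI(2)[OF 1(1)] sym_hullI(2)[OF pure(1)]] d 1 pure by simp
    qed
  qed
  ultimately show ?thesis unfolding distinct_sums_def by blast
qed

text \<open>With one pair of \<open>S'\<close> fixed, distinct product sums make
  \<open>r + t\<close> incongruent on the hull, which is skewness of \<open>T\<close>. Completeness
  then lifts any zero sum or coincidence modulo \<open>n\<close> in \<open>S'\<close> to one modulo
  \<open>n * m\<close>.\<close>

lemma distinct_sums_factors:
  assumes dW: "distinct_sums (n * m) W'" and ne: "S' \<noteq> {}"
  shows "distinct_sums n S'" "covers m 1 T'"
proof -
  obtain x0 y0 where s0: "(x0, y0) \<in> S'" using ne by auto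
  have "r = r' \<and> t = t'"
    if h: "(r, t) \<in> U" "(r', t') \<in> U" "m dvd (r + 1 * t) - (r' + 1 * t')" for r t r' t'
  proof -
    have "((n * r + x0) + (n * t + y0)) - ((n * r' + x0) + (n * t' + y0))
        = n * ((r + 1 * t) - (r' + 1 * t'))" by (simp add: algebra_simps)
    then have "n * m dvd ((n * r + x0) + (n * t + y0)) - ((n * r' + x0) + (n * t' + y0))"
      using h(3) n_pos by simp
    from distinct_sumsD(2)[OF dW product_pairsI(1)[OF h(1) s0] product_pairsI(1)[OF h(2) s0] this]
    show ?thesis using n_pos by simp
  qed
  then have "incongruent 1" unfolding incongruent_def by blast
  then have comp: "complete 1" by (simp add: complete_iff_incongruent)
  then show "covers m 1 T'" by (simp add: complete_iff_covers)
  have "\<not> n dvd x + y" if xy: "(x, y) \<in> S'" for x y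
  proof
    assume "n dvd x + y"
    then obtain a where a: "x + y = n * a" by auto
    \<comment> \<open>The index is chosen to cancel the quotient \<open>a\<close>, which makes the
      whole product sum vanish modulo \<open>n * m\<close>.\<close>
    obtain r t where rt: "(r, t) \<in> U" "m dvd - a - (r + 1 * t)" using completeD[OF comp] by blast
    have "(n * r + x) + (n * t + y) = n * - (- a - (r + 1 * t))"
      using a by (simp add: algebra_simps)
    then have "n * m dvd (n * r + x) + (n * t + y)"
      using rt(2) by (simp only: dvd_scale dvd_minus_iff)
    then show False using distinct_sumsD(1)[OF dW product_pairsI(1)[OF rt(1) xy]] by blast
  qed
  moreover have "x = x' \<and> y = y'"
    if xy: "(x, y) \<in> S'" and xy': "(x', y') \<in> S'" and d: "n dvd (x + y) - (x' + y')" for x y x' y'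
  proof -
    obtain a where a: "(x + y) - (x' + y') = n * a" using d by auto
    obtain r t where rt: "(r, t) \<in> U" "m dvd a - (r + 1 * t)" using completeD[OF comp] by blast
    \<comment> \<open>The first pair is placed at index \<open>(0, 0)\<close>, the second at the
      index absorbing \<open>a\<close>; equality of the product pairs then forces equal
      remainders.\<close>
    have "((n * 0 + x) + (n * 0 + y)) - ((n * r + x') + (n * t + y')) = n * (a - (r + 1 * t))"
      using a by (simp add: algebra_simps)
    then have "n * m dvd ((n * 0 + x) + (n * 0 + y)) - ((n * r + x') + (n * t + y'))"
      using rt(2) n_pos by simp
    from distinct_sumsD(2)[OF dW product_pairsI(1)[OF sym_hullI(1) xy] product_pairsI(1)[OF rt(1) xy'] this]
    have "n * 0 + x = n * r + x'" "n * 0 + y = n * t + y'" by auto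
    then show ?thesis
      using mult_add_eq_cancel[of n 0 x r x'] mult_add_eq_cancel[of n 0 y t y']
        oriented_mem[OF orientedS xy] oriented_mem[OF orientedS xy'] by auto
  qed
  ultimately show "distinct_sums n S'" unfolding distinct_sums_def by blast
qed

end

section \<open>The Skolem gap bound\<close>

locale odd_product_setup = product_setup +
  assumes odd_n: "odd n" and odd_m: "odd m" and m_gt: "m > 1"
begin

text \<open>For \<open>m = 2 * p + 1\<close> and \<open>n = 2 * q + 1\<close> the half is
  \<open>n * p + q\<close>: the bounds of the factors combine exactly as the pairs do.\<close>

lemma half_product: "(n * m - 1) div 2 = n * ((m - 1) div 2) + (n - 1) div 2"
proof -
  obtain p q where "m = 2 * p + 1" "n = 2 * q + 1" using odd_m odd_n by (auto elim!: oddE)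
  then show ?thesis by (simp add: algebra_simps)
qed

lemma short_gaps_product:
  assumes gS: "short_gaps n S'" and gT: "short_gaps m T'"
  shows "short_gaps (n * m) W'"
proof -
  have scale: "\<bar>n * r - n * t\<bar> \<le> n * ((m - 1) div 2)" if "(r, t) \<in> U" for r t
  proof -
    have "\<bar>n * r - n * t\<bar> = n * \<bar>r - t\<bar>"
      using n_pos by (simp add: abs_mult flip: right_diff_distrib)
    then show ?thesis using short_gaps_hull[OF gT that] n_pos by simp
  qed
  have "\<bar>u - v\<bar> \<le> (n * m - 1) div 2" if "(u, v) \<in> W'" for u v
    using that
  proof (cases rule: product_pairs_cases)
    case (mixed r t x y)
    then show ?thesis
      using scale[OF mixed(1)] short_gapsD[OF gS mixed(2)] unfolding half_product by linarith
  next
    case (pure r t)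
    have "0 \<le> (n - 1) div 2" using n_pos by simp
    then show ?thesis
      using pure scale[OF sym_hullI(2)[OF pure(1)]] unfolding half_product by linarith
  qed
  then show ?thesis unfolding short_gaps_def by blast
qed

text \<open>
  Since \<open>T\<close> is a starter, some pair of \<open>T\<close> attains the largest gap \<open>(m - 1) / 2\<close>, and with it both
  signs occur in the symmetric hull. Adding any gap of \<open>S\<close> with the matching sign then bounds it.
\<close>

lemma short_gaps_factors:
  assumes gW: "short_gaps (n * m) W'" and cT: "covers m (-1) T'"
  shows "short_gaps n S'" "short_gaps m T'"
proof -
  define p where "p = (m - 1) div 2"
  define q where "q = (n - 1) div 2"
  have bound: "\<bar>u - v\<bar> \<le> n * p + q" if "(u, v) \<in> W'" for u v
    using short_gapsD[OF gW that] unfolding half_product p_def q_def .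
  have m: "m = 2 * p + 1" and n: "n = 2 * q + 1"
    unfolding p_def q_def using odd_m odd_n by (auto elim!: oddE)
  have T: "\<bar>r - t\<bar> \<le> p" if "(r, t) \<in> T'" for r t
  proof -
    have "n * \<bar>r - t\<bar> = \<bar>n * r - n * t\<bar>"
      using n_pos by (simp add: abs_mult flip: right_diff_distrib)
    also have "\<dots> \<le> n * p + q" by (rule bound[OF product_pairsI(2)[OF that]])
    \<comment> \<open>The slack \<open>q\<close> is smaller than \<open>n\<close>, so it cannot
      raise the integer gap in \<open>T'\<close> above \<open>p\<close>.\<close>
    also have "\<dots> < n * (p + 1)" using n n_pos by (simp add: algebra_simps)
    finally show ?thesis using n_pos by simp
  qed
  then show "short_gaps m T'" unfolding short_gaps_def p_def by blast
  have "\<not> m dvd p" using m m_gt by (auto dest: zdvd_imp_le)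
  then obtain r t where rt: "(r, t) \<in> T'" "m dvd p - (r - t) \<or> m dvd p + (r - t)"
    using coversD(2)[OF cT, of p] by auto
  \<comment> \<open>Both expressions lie between 0 and \<open>2 * p\<close>, which is below
    \<open>m\<close>, so the one divisible by \<open>m\<close> is 0.\<close>
  have "p - (r - t) = 0 \<or> p + (r - t) = 0"
  proof -
    have "z = 0" if "m dvd z" "0 \<le> z" "z < m" for z
      using that zdvd_not_zless[of z m] by linarith
    from this[of "p - (r - t)"] this[of "p + (r - t)"] show ?thesis
      using rt(2) T[OF rt(1)] m by linarith
  qed
  then have ext: "r - t = p \<or> r - t = - p" by linarith
  have neg: "(- r) mod m - (- t) mod m = - (r - t)"
    using oriented_mem[OF oriented rt(1)] by (simp add: neg_mod_eq)
  obtain r1 t1 where 1: "(r1, t1) \<in> U" "r1 - t1 = p"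
    using ext neg sym_hullI(2,3)[OF rt(1), of m] by (metis minus_minus)
  obtain r2 t2 where 2: "(r2, t2) \<in> U" "r2 - t2 = - p"
    using ext neg sym_hullI(2,3)[OF rt(1), of m] by (metis minus_minus)
  have "\<bar>x - y\<bar> \<le> q" if "(x, y) \<in> S'" for x y
  proof -
    have "(n * r1 + x) - (n * t1 + y) = n * p + (x - y)"
      unfolding 1(2)[symmetric] by (simp add: algebra_simps)
    moreover have "(n * r2 + x) - (n * t2 + y) = - (n * p) + (x - y)"
      using arg_cong[OF 2(2), of "\<lambda>z. n * z"] by (simp add: algebra_simps)
    ultimately show ?thesis
      using bound[OF product_pairsI(1)[OF 1(1) that]] bound[OF product_pairsI(1)[OF 2(1) that]]
      by linarith
  qed
  then show "short_gaps n S'" unfolding short_gaps_def q_def by blast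
qed

text \<open>The entries of an oriented set lie in \<open>{1..<n * m}\<close>, so the reductions in
  the original definition change nothing.\<close>

lemma product_of_orderings_eq: "product_of_orderings n m S' T' = unordered ` W'"
proof -
  have mod: "u mod (n * m) = u" "v mod (n * m) = v" if "(u, v) \<in> W'" for u v
    using oriented_mem[OF oriented_product that] by auto
  have mixed: "{(n * r + x) mod (n * m), (n * t + y) mod (n * m)} = {n * r + x, n * t + y}"
    if "(r, t) \<in> U" "(x, y) \<in> S'" for r t x y
    using mod[OF product_pairsI(1)[OF that]] by simp
  have pure: "{(n * r) mod (n * m), (n * t) mod (n * m)} = {n * r, n * t}"
    if "(r, t) \<in> T'" for r t
    using mod[OF product_pairsI(2)[OF that]] by (simp only:)
  have "product_of_orderings n m S' T' =
    {{n * r + x, n * t + y} | r t x y. (r, t) \<in> U \<and> (x, y) \<in> S'}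
    \<union> {{n * r, n * t} | r t. (r, t) \<in> T'}"
    unfolding product_of_orderings_def sym_hull_def[symmetric]
    by (intro arg_cong2[of _ _ _ _ "(\<union>)"] Collect_cong ex_cong1)
      (simp_all only: mixed pure cong: rev_conj_cong)
  also have "\<dots> = unordered ` W'"
    unfolding product_pairs_def image_Un image_Collect4 image_Collect2 by simp
  finally show ?thesis .
qed

end

section \<open>Assembly of the four implications\<close>

lemma strong_skew_starter_oriented_iff:
  assumes "k > 0" "oriented k Q"
  shows "strong_skolem_starter k (unordered ` Q) \<longleftrightarrow>
       covers k (-1) Q \<and> short_gaps k Q \<and> distinct_sums k Q"
    "skew_skolem_starter k (unordered ` Q) \<longleftrightarrow>
       covers k (-1) Q \<and> short_gaps k Q \<and> covers k 1 Q"
  using starter_iff[OF assms] skolem_iff[OF assms(1), of Q] strong_iff[OF assms(2)] skew_iff[OF assms]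
  unfolding strong_skolem_starter_def skew_skolem_starter_def skolem_starter_def by blast+

text \<open>Distinct representatives below \<open>k\<close> are incongruent; this supplies the
  premise \<open>nz\<close> of \<open>covers_factors\<close> for \<open>e = -1\<close>.\<close>

lemma oriented_diff_not_dvd:
  assumes "oriented k Q" "(x, y) \<in> Q"
  shows "\<not> k dvd x + (-1) * y"
proof
  assume "k dvd x + (-1) * y"
  then have "x mod k = y mod k" by (simp add: mod_eq_dvd_iff)
  then show False using oriented_mem[OF assms] by simp
qed

theorem theorem3p10:
  fixes n m :: int and S T W :: "int set set"
  assumes "n \<ge> 3" and "odd n" and "m \<ge> 3" and "odd m"
    and "two_partition n S" and "two_partition m T"
    and "is_product n m S T W"
  shows "(strong_skolem_starter n S \<and> skew_skolem_starter m T
            \<longrightarrow> strong_skolem_starter (n * m) W)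
       \<and> (skew_skolem_starter n S \<and> skew_skolem_starter m T
            \<longrightarrow> skew_skolem_starter (n * m) W)
       \<and> (strong_skolem_starter (n * m) W \<and> \<not> skew (n * m) W
            \<longrightarrow> strong_skolem_starter n S \<and> \<not> skew n S \<and> skew_skolem_starter m T)
       \<and> (skew_skolem_starter (n * m) W
            \<longrightarrow> skew_skolem_starter n S \<and> skew_skolem_starter m T)"
proof -
  obtain S' T' where S': "ordering_of S' S" and T': "admissible_ordering m T' T"
    and W: "W = product_of_orderings n m S' T'"
    using assms(7) unfolding is_product_def by blast
  have oT: "ordering_of T' T" using T' unfolding admissible_ordering_def by simp
  note S = oriented_of_ordering[OF assms(5) S'] and T = oriented_of_ordering[OF assms(6) oT]
  interpret odd_product_setup m T' n S'
  proof unfold_locales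
    show "m > 0" "n > 0" "m > 1" using assms(1,3) by linarith+
    show "(\<Union>(r, t)\<in>T'. {r mod m, (- r) mod m}) = {1..<m}"
      using T' unfolding admissible_ordering_def by blast
  qed (fact S(1) T(1) assms(2,4))+
  have pos: "n * m > 0" using n_pos m_pos by simp
  have "{1..<n} \<noteq> {}" using assms(1) by simp
  \<comment> \<open>A pair of \<open>S'\<close> must exist to be held fixed in
    \<open>distinct_sums_factors\<close>.\<close>
  then have ne: "S' \<noteq> {}" using orientedS unfolding oriented_def by auto
  note W_eq = W[unfolded product_of_orderings_eq]
  note char = strong_skew_starter_oriented_iff[OF n_pos orientedS, folded S(2)]
    strong_skew_starter_oriented_iff[OF m_pos oriented, folded T(2)]
    strong_skew_starter_oriented_iff[OF pos oriented_product, folded W_eq]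
    skew_iff[OF n_pos orientedS, folded S(2)] skew_iff[OF pos oriented_product, folded W_eq]
  have skolem_product: "covers (n * m) (-1) W' \<and> short_gaps (n * m) W'"
    if "covers n (-1) S'" "short_gaps n S'" "covers m (-1) T'" "short_gaps m T'"
    using covers_product that short_gaps_product by simp
  have skolem_factors: "covers n (-1) S' \<and> covers m (-1) T' \<and> short_gaps n S' \<and> short_gaps m T'"
    if "covers (n * m) (-1) W'" "short_gaps (n * m) W'"
    using covers_factors[OF that(1) oriented_diff_not_dvd[OF orientedS]]
      short_gaps_factors[OF that(2)] by blast
  \<comment> \<open>A skew product has distinct nonzero sums, so those of \<open>S'\<close> are
    nonzero modulo \<open>n\<close>, which is \<open>nz\<close> for \<open>e = 1\<close>.\<close>
  have skew_factors: "covers n 1 S' \<and> covers m 1 T'" if c: "covers (n * m) 1 W'"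
  proof -
    have "distinct_sums n S'"
      using distinct_sums_factors(1)[OF distinct_sums_of_covers[OF pos oriented_product c] ne] .
    from distinct_sumsD(1)[OF this] show ?thesis using covers_factors[OF c] by simp
  qed
  \<comment> \<open>In the third implication strongness of the product already makes
    \<open>T\<close> skew; were \<open>S\<close> skew too, \<open>covers_product\<close> with
    \<open>e = 1\<close> would make the product skew.\<close>
  show ?thesis
    unfolding char
    using skolem_product covers_product[of 1] distinct_sums_product
      skolem_factors skew_factors distinct_sums_factors[OF _ ne] by argo
qed

end
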